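(* Let $\rho\ge 1$ and $b\ge 2$ be integers. Let $\overline{C}_b^\rho(n)$ be the number of $\rho$-color $b$-ary partitions of $n$ in which the multiplicity of each part with color $i$ is a multiple of $i$, and let $\overline{Y}_n$ be the number of ordinary partitions of $n$ with parts not exceeding $\rho$. Then for all integers $n\ge 0$, $$\overline{C}_b^\rho(bn+j)=\sum_{k=0}^n\overline{Y}_{bk+j}\,\overline{C}_b^\rho(n-k)\qquad(j=0,1,\ldots,b-1).$$
   Context: A $\rho$-color $b$-ary partition of $n$ is a finite multiset of colored parts, each being a power $b^j$ ($j\ge0$) with a color $i\in\{1,\dots,\rho\}$, with sum $n$ (order irrelevant). The condition means that for every $j\ge 0$ and every $i$ the number of occurrences of the colored part $(b^j,i)$ is a (possibly zero) multiple of $i$. Conventions: $\overline{C}_b^\rho(0)=1$, $\overline{Y}_0=1$. Equivalently, $\sum_{n\ge0}\overline{C}_b^\rho(n)q^n=\prod_{j=0}^\infty\prod_{i=1}^\rho\frac{1}{1-q^{ib^j}}$ and $\sum_{n\ge0}\overline{Y}_nq^n=\prod_{i=1}^\rho\frac{1}{1-q^i}$. *)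

theory Defs
  imports Complex_Main "HOL-Library.Multiset"
begin

text \<open>A coloured part is a pair \<open>(b ^ j, i)\<close> of its size and its colour.\<close>

definition color_bary_partitions :: "nat \<Rightarrow> nat \<Rightarrow> nat \<Rightarrow> (nat \<times> nat) multiset set" where
  "color_bary_partitions b \<rho> n =
     {M. set_mset M \<subseteq> range (\<lambda>j. b ^ j) \<times> {1..\<rho>} \<and> (\<Sum>p\<in>#M. fst p) = n}"

text \<open>Parts that do not occur have multiplicity \<open>0\<close>, a multiple of every colour.\<close>

definition Cbar :: "nat \<Rightarrow> nat \<Rightarrow> nat \<Rightarrow> nat" where
  "Cbar b \<rho> n =
     card {M \<in> color_bary_partitions b \<rho> n. \<forall>j. \<forall>i\<in>{1..\<rho>}. i dvd count M (b ^ j, i)}"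

definition Ybar :: "nat \<Rightarrow> nat \<Rightarrow> nat" where
  "Ybar \<rho> n = card {M :: nat multiset. set_mset M \<subseteq> {1..\<rho>} \<and> \<Sum>\<^sub># M = n}"

text \<open>
  The sets counted above are finite (for \<open>b \<ge> 1\<close>), so \<open>card\<close> is the true cardinality;
  the conventions for \<open>n = 0\<close> hold automatically.
\<close>

lemma size_le_sum_mset_pos:
  fixes f :: "'a \<Rightarrow> nat"
  assumes "\<And>x. x \<in># M \<Longrightarrow> f x \<ge> 1"
  shows "size M \<le> (\<Sum>x\<in>#M. f x)"
  using assms
proof (induction M)
  case (add x M)
  have "f x \<ge> 1" "size M \<le> (\<Sum>x\<in>#M. f x)"
    using add by auto
  then show ?case by simp
qed simp

lemma member_le_sum_mset:
  fixes f :: "'a \<Rightarrow> nat"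
  assumes "x \<in># M"
  shows "f x \<le> (\<Sum>x\<in>#M. f x)"
  using assms by (metis image_mset_add_mset insert_DiffM le_add1 sum_mset.add_mset)

lemma finite_bounded_multisets:
  assumes "finite A"
  shows "finite {M. set_mset M \<subseteq> A \<and> size M \<le> n}"
proof -
  have "{M. set_mset M \<subseteq> A \<and> size M \<le> n} \<subseteq> mset ` {xs. set xs \<subseteq> A \<and> length xs \<le> n}"
  proof
    fix M assume "M \<in> {M. set_mset M \<subseteq> A \<and> size M \<le> n}"
    moreover obtain xs where "M = mset xs" by (metis ex_mset)
    ultimately show "M \<in> mset ` {xs. set xs \<subseteq> A \<and> length xs \<le> n}" by auto
  qed
  then show ?thesis
    using finite_lists_length_le[OF assms] by (meson finite_imageI finite_subset)
qed

lemma finite_color_bary_partitions: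
  assumes "b \<ge> 1"
  shows "finite (color_bary_partitions b \<rho> n)"
proof (rule finite_subset)
  show "color_bary_partitions b \<rho> n \<subseteq> {M. set_mset M \<subseteq> {0..n} \<times> {1..\<rho>} \<and> size M \<le> n}"
  proof
    fix M assume M: "M \<in> color_bary_partitions b \<rho> n"
    then have sub: "set_mset M \<subseteq> range (\<lambda>j. b ^ j) \<times> {1..\<rho>}" and s: "(\<Sum>p\<in>#M. fst p) = n"
      by (auto simp: color_bary_partitions_def)
    have "fst p \<ge> 1" if "p \<in># M" for p
      using that sub assms by auto
    then have "size M \<le> n"
      using size_le_sum_mset_pos[of M fst] s by simp
    moreover have "fst p \<le> n" if "p \<in># M" for p
      using member_le_sum_mset[OF that, of fst] s by simp
    ultimately show "M \<in> {M. set_mset M \<subseteq> {0..n} \<times> {1..\<rho>} \<and> size M \<le> n}"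
      using sub by fastforce
  qed
qed (intro finite_bounded_multisets, simp)

lemma finite_bounded_partitions:
  "finite {M :: nat multiset. set_mset M \<subseteq> {1..\<rho>} \<and> \<Sum>\<^sub># M = n}"
proof (rule finite_subset)
  show "{M. set_mset M \<subseteq> {1..\<rho>} \<and> \<Sum>\<^sub># M = n} \<subseteq> {M. set_mset M \<subseteq> {1..\<rho>} \<and> size M \<le> n}"
  proof clarsimp
    fix M assume "set_mset M \<subseteq> {Suc 0..\<rho>}"
    then show "size M \<le> \<Sum>\<^sub># M"
      using size_le_sum_mset_pos[of M "\<lambda>x. x"] by fastforce
  qed
qed (intro finite_bounded_multisets, simp)

lemma Ybar_0: "Ybar \<rho> 0 = 1"
proof -
  have "{M :: nat multiset. set_mset M \<subseteq> {1..\<rho>} \<and> \<Sum>\<^sub># M = 0} = {{#}}"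
    by (auto simp: subset_iff) (metis multiset_nonemptyE not_one_le_zero One_nat_def)
  then show ?thesis by (simp add: Ybar_def)
qed

lemma Cbar_0:
  assumes "b \<ge> 1"
  shows "Cbar b \<rho> 0 = 1"
proof -
  have "M = {#}" if "M \<in> color_bary_partitions b \<rho> 0" for M
  proof (rule ccontr)
    assume "M \<noteq> {#}"
    then obtain p where "p \<in># M" by (metis multiset_nonemptyE)
    moreover have "set_mset M \<subseteq> range (\<lambda>j. b ^ j) \<times> {1..\<rho>}" "\<forall>x\<in>#M. fst x = 0"
      using that by (auto simp: color_bary_partitions_def)
    ultimately have "p \<in> range (\<lambda>j. b ^ j) \<times> {1..\<rho>}" "fst p = 0"
      by blast+
    then show False using assms by auto
  qed
  moreover have "{#} \<in> color_bary_partitions b \<rho> 0"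
    by (simp add: color_bary_partitions_def)
  ultimately have "{M \<in> color_bary_partitions b \<rho> 0.
      \<forall>j. \<forall>i\<in>{1..\<rho>}. i dvd count M (b ^ j, i)} = {{#}}"
    by auto
  then show ?thesis by (simp add: Cbar_def)
qed

end

theory Submission
  imports Defs
begin

text \<open>
  A multiset counted by \<open>Cbar\<close> splits into its parts of size \<open>1\<close> and the rest. The parts
  \<open>(1, i)\<close> come in bundles of \<open>i\<close> copies, and reading each bundle as one part of size \<open>i\<close> turns
  them into an ordinary partition \<open>P\<close> with parts at most \<open>\<rho>\<close> and the same sum. All other sizes
  are divisible by \<open>b\<close>, and dividing them by \<open>b\<close> gives a multiset \<open>N\<close> of the original kind.
  So \<open>M\<close> corresponds to the pair \<open>(P, N)\<close>, as \<open>bij_betw_glue\<close> states without fixing any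
  sum; on generating functions this is the equation
  \<open>C(q) = C(q ^ b) * (\<Prod>i=1..\<rho>. 1 / (1 - q ^ i))\<close>. The sum of \<open>M\<close> is the sum of \<open>P\<close> plus \<open>b\<close>
  times the sum of \<open>N\<close>. If it equals \<open>b * n + j\<close> with \<open>j < b\<close>, then \<open>N\<close> has some sum \<open>n - k\<close>
  with \<open>k \<le> n\<close>, and \<open>P\<close> has sum \<open>b * k + j\<close>; counting the pairs for each \<open>k\<close> gives the
  recurrence.
\<close>

definition bounded_partitions :: "nat \<Rightarrow> nat multiset set" where
  "bounded_partitions \<rho> = {P. set_mset P \<subseteq> {1..\<rho>}}"

definition bundled_partitions :: "nat \<Rightarrow> nat \<Rightarrow> (nat \<times> nat) multiset set" where
  "bundled_partitions b \<rho> =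
     {M. set_mset M \<subseteq> range (\<lambda>j. b ^ j) \<times> {1..\<rho>} \<and>
         (\<forall>j. \<forall>i\<in>{1..\<rho>}. i dvd count M (b ^ j, i))}"

abbreviation weight :: "(nat \<times> nat) multiset \<Rightarrow> nat" where
  "weight M \<equiv> \<Sum>p\<in>#M. fst p"

definition unit_bundles :: "nat multiset \<Rightarrow> (nat \<times> nat) multiset" where
  "unit_bundles P = (\<Sum>i\<in>#P. replicate_mset i (1, i))"

definition scale_parts :: "nat \<Rightarrow> (nat \<times> nat) multiset \<Rightarrow> (nat \<times> nat) multiset" where
  "scale_parts b N = image_mset (map_prod ((*) b) id) N"

definition glue :: "nat \<Rightarrow> nat multiset \<times> (nat \<times> nat) multiset \<Rightarrow> (nat \<times> nat) multiset" where
  "glue b = (\<lambda>(P, N). unit_bundles P + scale_parts b N)"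

lemma Cbar_eq_card_bundled:
  "Cbar b \<rho> n = card {M \<in> bundled_partitions b \<rho>. weight M = n}"
  unfolding Cbar_def color_bary_partitions_def bundled_partitions_def
  by (rule arg_cong[of _ _ card]) auto

lemma Ybar_eq_card_bounded:
  "Ybar \<rho> n = card {P \<in> bounded_partitions \<rho>. \<Sum>\<^sub># P = n}"
  by (simp add: Ybar_def bounded_partitions_def)

lemma finite_bundled_partitions_weight:
  assumes "b \<ge> 1"
  shows "finite {M \<in> bundled_partitions b \<rho>. weight M = n}"
  using finite_color_bary_partitions[OF assms, of \<rho> n]
  by (rule rev_finite_subset) (auto simp: color_bary_partitions_def bundled_partitions_def)

lemma finite_bounded_partitions_sum:
  "finite {P \<in> bounded_partitions \<rho>. \<Sum>\<^sub># P = n}"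
  using finite_bounded_partitions[of \<rho> n] by (simp add: bounded_partitions_def)

lemma count_unit_bundles:
  "count (unit_bundles P) (s, i) = (if s = 1 then i * count P i else 0)"
  by (induction P) (auto simp: unit_bundles_def)

lemma weight_unit_bundles: "weight (unit_bundles P) = \<Sum>\<^sub># P"
  by (induction P) (auto simp: unit_bundles_def)

lemma weight_scale_parts: "weight (scale_parts b N) = b * weight N"
  by (induction N) (auto simp: scale_parts_def algebra_simps)

lemma weight_glue: "weight (glue b (P, N)) = \<Sum>\<^sub># P + b * weight N"
  by (simp add: glue_def weight_unit_bundles weight_scale_parts)

lemma count_scale_parts_mult:
  assumes "b \<ge> 1"
  shows "count (scale_parts b N) (b * s, i) = count N (s, i)"
  using assms by (induction N) (auto simp: scale_parts_def)

lemma count_scale_parts_1: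
  assumes "b \<ge> 2"
  shows "count (scale_parts b N) (1, i) = 0"
  using assms by (auto simp: scale_parts_def count_eq_zero_iff)

lemma count_glue_1:
  assumes "b \<ge> 2"
  shows "count (glue b (P, N)) (1, i) = i * count P i"
  using count_scale_parts_1[OF assms] by (simp add: glue_def count_unit_bundles)

lemma count_glue_mult:
  assumes "b \<ge> 2"
  shows "count (glue b (P, N)) (b * s, i) = count N (s, i)"
  using assms by (simp add: glue_def count_unit_bundles count_scale_parts_mult)

lemma glue_in_bundled:
  assumes b: "b \<ge> 2" and P: "P \<in> bounded_partitions \<rho>" and N: "N \<in> bundled_partitions b \<rho>"
  shows "glue b (P, N) \<in> bundled_partitions b \<rho>"
proof -
  have "p \<in> range (\<lambda>j. b ^ j) \<times> {1..\<rho>}" if "p \<in># glue b (P, N)" for p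
  proof -
    consider i where "i \<in># P" "p = (1, i)"
      | s i where "(s, i) \<in># N" "p = (b * s, i)"
      using \<open>p \<in># glue b (P, N)\<close>
      by (auto simp: glue_def unit_bundles_def scale_parts_def split: if_splits)
    then show ?thesis
    proof cases
      case 1
      moreover have "(1::nat) = b ^ 0" by simp
      ultimately show ?thesis using P unfolding bounded_partitions_def by blast
    next
      case 2
      then obtain j where "s = b ^ j" "i \<in> {1..\<rho>}"
        using N by (fastforce simp: bundled_partitions_def)
      moreover from this have "b * s = b ^ Suc j" by simp
      ultimately show ?thesis using 2 by blast
    qed
  qed
  moreover have "i dvd count (glue b (P, N)) (b ^ j, i)" if "i \<in> {1..\<rho>}" for i j
  proof (cases j)
    case 0
    then show ?thesis using count_glue_1[OF b] by simp
  next
    case (Suc j')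
    then show ?thesis
      using count_glue_mult[OF b, of P N "b ^ j'"] N that by (simp add: bundled_partitions_def)
  qed
  ultimately show ?thesis by (auto simp: bundled_partitions_def)
qed

text \<open>
  The size-\<open>1\<close> parts of a glued multiset come only from the bundles, because \<open>b * s \<noteq> 1\<close>. So
  the multiplicities of these parts and of the parts of size \<open>b * s\<close> recover both components.
\<close>

lemma inj_on_glue:
  assumes b: "b \<ge> 2"
  shows "inj_on (glue b) (bounded_partitions \<rho> \<times> bundled_partitions b \<rho>)"
proof (rule inj_onI, clarify)
  fix P N P' N'
  assume P: "P \<in> bounded_partitions \<rho>" and P': "P' \<in> bounded_partitions \<rho>"
    and eq: "glue b (P, N) = glue b (P', N')"
  have "count P i = count P' i" for i
  proof (cases "i = 0")
    case True
    \<comment> \<open>A bundle of \<open>0\<close> copies leaves no trace in the glued multiset, so the multiplicity of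
      the part \<open>0\<close> has to come from the range of the parts.\<close>
    have "0 \<notin># P" "0 \<notin># P'" using P P' by (auto simp: bounded_partitions_def)
    then show ?thesis using True by (simp add: not_in_iff)
  next
    case False
    then show ?thesis
      using count_glue_1[OF b, of P N i] count_glue_1[OF b, of P' N' i] eq by simp
  qed
  moreover have "count N (s, i) = count N' (s, i)" for s i
    using count_glue_mult[OF b, of P N s i] count_glue_mult[OF b, of P' N' s i] eq by simp
  ultimately show "P = P' \<and> N = N'" by (auto intro!: multiset_eqI)
qed

text \<open>
  A size \<open>b ^ l\<close> other than \<open>1\<close> has \<open>l > 0\<close>, so \<open>b\<close> divides it and the quotient is again a
  power of \<open>b\<close>; the divisibility of the multiplicities by the colours, taken at size \<open>1\<close>,
  makes the bundles come out even.
\<close>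

lemma glue_surj:
  assumes b: "b \<ge> 2" and M: "M \<in> bundled_partitions b \<rho>"
  shows "\<exists>P\<in>bounded_partitions \<rho>. \<exists>N\<in>bundled_partitions b \<rho>. M = glue b (P, N)"
proof -
  define P where "P = (\<Sum>i\<in>{1..\<rho>}. replicate_mset (count M (1, i) div i) i)"
  define R where "R = filter_mset (\<lambda>p. fst p \<noteq> 1) M"
  define N where "N = image_mset (map_prod (\<lambda>s. s div b) id) R"
  have M_sub: "\<exists>l. s = b ^ l" "i \<in> {1..\<rho>}" if "(s, i) \<in># M" for s i
    using M that by (auto simp: bundled_partitions_def)
  have dvd_M: "i dvd count M (b ^ l, i)" if "i \<in> {1..\<rho>}" for i l
    using M that by (simp add: bundled_partitions_def)
  have count_P: "count P i = (if i \<in> {1..\<rho>} then count M (1, i) div i else 0)" for i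
    by (simp add: P_def count_sum if_distrib cong: if_cong)
  have P: "P \<in> bounded_partitions \<rho>"
    by (auto simp: bounded_partitions_def count_P simp flip: count_greater_zero_iff
      split: if_splits)
  have R_Suc: "\<exists>l. s = b ^ Suc l" if "(s, i) \<in># R" for s i
  proof -
    have "(s, i) \<in># M" "s \<noteq> 1" using that by (auto simp: R_def)
    moreover from this obtain l where "s = b ^ l" using M_sub(1) by blast
    ultimately show ?thesis by (cases l) auto
  qed
  have scale_N: "scale_parts b N = R"
  proof -
    have "scale_parts b N = image_mset (map_prod (\<lambda>s. b * (s div b)) id) R"
      by (simp add: scale_parts_def N_def multiset.map_comp prod.map_comp comp_def id_def)
    also have "\<dots> = image_mset (\<lambda>p. p) R"
      by (rule image_mset_cong) (use R_Suc b in fastforce)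
    finally show ?thesis by simp
  qed
  have "unit_bundles P = filter_mset (\<lambda>p. fst p = 1) M"
  proof (rule multiset_eqI, clarify)
    fix s i
    have "i * count P i = count M (1, i)"
      using dvd_M[of i 0] M_sub(2)[of 1 i] by (auto simp: count_P count_eq_zero_iff)
    then show "count (unit_bundles P) (s, i) = count (filter_mset (\<lambda>p. fst p = 1) M) (s, i)"
      by (simp add: count_unit_bundles)
  qed
  then have glue: "M = glue b (P, N)"
    by (simp add: glue_def scale_N R_def multiset_partition[symmetric])
  have "\<exists>l. s = b ^ l" "i \<in> {1..\<rho>}" if "(s, i) \<in># N" for s i
  proof -
    have "(b * s, i) \<in># R"
      using that by (force simp: scale_N[symmetric] scale_parts_def)
    then show "\<exists>l. s = b ^ l" "i \<in> {1..\<rho>}"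
      using R_Suc[of "b * s" i] M_sub(2)[of "b * s" i] b by (auto simp: R_def)
  qed
  moreover have "i dvd count N (b ^ l, i)" if "i \<in> {1..\<rho>}" for i l
    using dvd_M[OF that, of "Suc l"] count_glue_mult[OF b, of P N "b ^ l" i] glue by simp
  ultimately have "N \<in> bundled_partitions b \<rho>"
    by (fastforce simp: bundled_partitions_def image_iff)
  with P glue show ?thesis by blast
qed

lemma bij_betw_glue:
  assumes "b \<ge> 2"
  shows "bij_betw (glue b) (bounded_partitions \<rho> \<times> bundled_partitions b \<rho>)
           (bundled_partitions b \<rho>)"
  unfolding bij_betw_def
  using inj_on_glue[OF assms] glue_in_bundled[OF assms] glue_surj[OF assms] by (auto, blast)

text \<open>
  Division with remainder: \<open>j < b\<close> forces \<open>w \<le> n\<close>, so that the difference \<open>n - w\<close> is not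
  truncated.
\<close>

lemma sum_split_iff:
  fixes b n j s w :: nat
  assumes "j < b"
  shows "s + b * w = b * n + j \<longleftrightarrow> (\<exists>k\<in>{0..n}. s = b * k + j \<and> w = n - k)"
proof
  assume eq: "s + b * w = b * n + j"
  have "b * w < b * Suc n" using eq assms by simp
  then have "w < Suc n" by (simp only: mult_less_cancel1)
  then have "w \<le> n" by simp
  then obtain k where "n = w + k" using le_Suc_ex by blast
  then show "\<exists>k\<in>{0..n}. s = b * k + j \<and> w = n - k"
    using eq by (intro bexI[of _ k]) (auto simp: algebra_simps)
next
  assume "\<exists>k\<in>{0..n}. s = b * k + j \<and> w = n - k"
  then obtain k where "k \<le> n" "s = b * k + j" "w = n - k" by auto
  moreover from \<open>k \<le> n\<close> obtain m where "n = k + m" using le_Suc_ex by blast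
  ultimately show "s + b * w = b * n + j" by (simp add: algebra_simps)
qed

theorem proposition6p9:
  fixes b \<rho> n j :: nat
  assumes "\<rho> \<ge> 1" and "b \<ge> 2" and "j < b"
  shows "Cbar b \<rho> (b * n + j) = (\<Sum>k=0..n. Ybar \<rho> (b * k + j) * Cbar b \<rho> (n - k))"
proof -
  define Y where "Y m = {P \<in> bounded_partitions \<rho>. \<Sum>\<^sub># P = m}" for m
  define C where "C m = {M \<in> bundled_partitions b \<rho>. weight M = m}" for m
  define A where "A = (\<Union>k\<in>{0..n}. Y (b * k + j) \<times> C (n - k))"
  have fin: "finite (Y m)" "finite (C m)" for m
    using finite_bounded_partitions_sum finite_bundled_partitions_weight assms(2)
    by (auto simp: Y_def C_def)
  have A_eq: "A = {x \<in> bounded_partitions \<rho> \<times> bundled_partitions b \<rho>.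
                     weight (glue b x) = b * n + j}"
  proof (rule set_eqI, clarify)
    fix P N
    show "(P, N) \<in> A \<longleftrightarrow> (P, N) \<in> {x \<in> bounded_partitions \<rho> \<times> bundled_partitions b \<rho>.
            weight (glue b x) = b * n + j}"
      by (simp add: A_def Y_def C_def weight_glue sum_split_iff[OF assms(3)]) blast
  qed
  have "bij_betw (glue b) A (C (b * n + j))"
    using bij_betw_glue[OF assms(2), of \<rho>] unfolding A_eq C_def bij_betw_def
    by (auto simp: inj_on_def)
  then have "Cbar b \<rho> (b * n + j) = card A"
    by (simp add: Cbar_eq_card_bundled C_def bij_betw_same_card)
  also have "\<dots> = (\<Sum>k=0..n. card (Y (b * k + j) \<times> C (n - k)))"
    unfolding A_def by (rule card_UN_disjoint) (simp_all add: fin, auto simp: C_def)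
  also have "\<dots> = (\<Sum>k=0..n. Ybar \<rho> (b * k + j) * Cbar b \<rho> (n - k))"
    by (simp add: card_cartesian_product Y_def C_def Ybar_eq_card_bounded Cbar_eq_card_bundled)
  finally show ?thesis .
qed

end
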